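(* Let $G$ be a countably infinite amenable group and $G\curvearrowright X$ an expansive action on a compact metrizable space by homeomorphisms with the strong topological Markov property. Then $\mathrm{IE}_k(X,G)\subseteq\overline{\mathtt{A}_k(X,G)}$ for every integer $k\ge2$, where the closure is taken in $X^k$.
   Context: Fix a compatible metric $d$ on $X$ (the notions below do not depend on its choice). For $K\subset G$ and $x,y\in X$ write $d_K(x,y)=\sup_{g\in K}d(gx,gy)$. Expansive: there is $c>0$ such that for all $x\neq y$ in $X$ there is $g\in G$ with $d(gx,gy)>c$. $\mathtt{A}_k(X,G)$ is the set of asymptotic $k$-tuples: $(x_1,\dots,x_k)\in X^k$ such that for every $\varepsilon>0$ there is a finite $F\subset G$ with $d(gx_i,gx_j)\le\varepsilon$ for all $g\notin F$ and $1\le i,j\le k$. Memory set: for $\varepsilon,\delta>0$ and finite $A\subset B\subset G$, $B$ is an $(\varepsilon,\delta)$-memory set for $A$ if for every $x,y\in X$ with $d_{B\setminus A}(x,y)\le\delta$ there is $z\in X$ with $d_B(x,z)\le\varepsilon$ and $d_{G\setminus A}(y,z)\le\varepsilon$. Strong topological Markov property: for every $\varepsilon>0$ there exist $\delta>0$ and a finite set $F\subset G$ containing the identity such that for every finite $A\subset G$ the set $FA$ is an $(\varepsilon,\delta)$-memory set for $A$. Independence: for a tuple $\mathbf A=(A_1,\dots,A_k)$ of subsets of $X$, $J\subset G$ is an independence set for $\mathbf A$ if for every nonempty finite $I\subset J$ and every $\phi:I\to\{1,\dots,k\}$ we have $\bigcap_{s\in I}s^{-1}A_{\phi(s)}\neq\varnothing$.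 The independence density of $\mathbf A$ is the largest $q\ge0$ such that every finite $F\subset G$ has a subset of cardinality at least $q|F|$ which is an independence set for $\mathbf A$. $\mathrm{IE}_k(X,G)$ is the set of $(x_1,\dots,x_k)\in X^k$ such that for every product neighborhood $U_1\times\dots\times U_k$ of it the tuple $(U_1,\dots,U_k)$ has positive independence density. *)

theory Defs
  imports "HOL-Analysis.Analysis" "HOL-Algebra.Group_Action"
begin

text \<open>
  An action of a group \<open>G\<close> on the space \<open>X\<close> is a map \<open>\<phi>\<close> with
  \<^term>\<open>group_action G (topspace X) \<phi>\<close>; the point \<open>gx\<close> is \<open>\<phi> g x\<close>, and \<open>d\<close> is a
  metric on \<^term>\<open>topspace X\<close>. Points of \<open>X\<^sup>k\<close> are the functions in
  \<^term>\<open>{1..k} \<rightarrow>\<^sub>E topspace X\<close>, as for \<^const>\<open>product_topology\<close>.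
\<close>

text \<open>Amenability of a discrete group, by the Folner condition.\<close>

definition amenable :: "('g, 'b) monoid_scheme \<Rightarrow> bool" where
  "amenable G \<longleftrightarrow>
     (\<forall>K \<epsilon>. finite K \<and> K \<subseteq> carrier G \<and> 0 < \<epsilon> \<longrightarrow>
        (\<exists>F. finite F \<and> F \<noteq> {} \<and> F \<subseteq> carrier G \<and>
             (\<forall>s\<in>K. real (card (sym_diff (s <#\<^bsub>G\<^esub> F) F)) \<le> \<epsilon> * real (card F))))"

definition expansive ::
  "('g, 'b) monoid_scheme \<Rightarrow> 'x topology \<Rightarrow> ('x \<Rightarrow> 'x \<Rightarrow> real) \<Rightarrow> ('g \<Rightarrow> 'x \<Rightarrow> 'x) \<Rightarrow> bool"
where
  "expansive G X d \<phi> \<longleftrightarrow>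
     (\<exists>c>0. \<forall>x\<in>topspace X. \<forall>y\<in>topspace X. x \<noteq> y \<longrightarrow>
        (\<exists>g\<in>carrier G. d (\<phi> g x) (\<phi> g y) > c))"

definition asymptotic_tuples ::
  "('g, 'b) monoid_scheme \<Rightarrow> 'x topology \<Rightarrow> ('x \<Rightarrow> 'x \<Rightarrow> real) \<Rightarrow> ('g \<Rightarrow> 'x \<Rightarrow> 'x) \<Rightarrow> nat
    \<Rightarrow> (nat \<Rightarrow> 'x) set"
where
  "asymptotic_tuples G X d \<phi> k =
     {x \<in> {1..k} \<rightarrow>\<^sub>E topspace X.
        \<forall>\<epsilon>>0. \<exists>F. finite F \<and> F \<subseteq> carrier G \<and>
          (\<forall>g \<in> carrier G - F. \<forall>i\<in>{1..k}. \<forall>j\<in>{1..k}. d (\<phi> g (x i)) (\<phi> g (x j)) \<le> \<epsilon>)}"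

text \<open>
  The supremum is taken in \<open>[0, \<infinity>)\<close>: the inserted \<open>0\<close> only matters for \<open>K = {}\<close>.
  For infinite \<open>K\<close> it is meaningful because a compact metric space is bounded.
\<close>

definition sup_dist ::
  "('x \<Rightarrow> 'x \<Rightarrow> real) \<Rightarrow> ('g \<Rightarrow> 'x \<Rightarrow> 'x) \<Rightarrow> 'g set \<Rightarrow> 'x \<Rightarrow> 'x \<Rightarrow> real"
where
  "sup_dist d \<phi> K x y = Sup (insert 0 ((\<lambda>g. d (\<phi> g x) (\<phi> g y)) ` K))"

text \<open>Intended for finite \<open>A \<subseteq> B \<subseteq> carrier G\<close>.\<close>

definition memory_set ::
  "('g, 'b) monoid_scheme \<Rightarrow> 'x topology \<Rightarrow> ('x \<Rightarrow> 'x \<Rightarrow> real) \<Rightarrow> ('g \<Rightarrow> 'x \<Rightarrow> 'x)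
    \<Rightarrow> real \<Rightarrow> real \<Rightarrow> 'g set \<Rightarrow> 'g set \<Rightarrow> bool"
where
  "memory_set G X d \<phi> \<epsilon> \<delta> A B \<longleftrightarrow>
     (\<forall>x\<in>topspace X. \<forall>y\<in>topspace X. sup_dist d \<phi> (B - A) x y \<le> \<delta> \<longrightarrow>
        (\<exists>z\<in>topspace X. sup_dist d \<phi> B x z \<le> \<epsilon> \<and> sup_dist d \<phi> (carrier G - A) y z \<le> \<epsilon>))"

definition strong_topological_Markov_property ::
  "('g, 'b) monoid_scheme \<Rightarrow> 'x topology \<Rightarrow> ('x \<Rightarrow> 'x \<Rightarrow> real) \<Rightarrow> ('g \<Rightarrow> 'x \<Rightarrow> 'x) \<Rightarrow> bool"
where
  "strong_topological_Markov_property G X d \<phi> \<longleftrightarrow>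
     (\<forall>\<epsilon>>0. \<exists>\<delta>>0. \<exists>F. finite F \<and> F \<subseteq> carrier G \<and> \<one>\<^bsub>G\<^esub> \<in> F \<and>
        (\<forall>A. finite A \<and> A \<subseteq> carrier G \<longrightarrow> memory_set G X d \<phi> \<epsilon> \<delta> A (F <#>\<^bsub>G\<^esub> A)))"

definition independence_set ::
  "('g, 'b) monoid_scheme \<Rightarrow> 'x topology \<Rightarrow> ('g \<Rightarrow> 'x \<Rightarrow> 'x) \<Rightarrow> nat \<Rightarrow> (nat \<Rightarrow> 'x set)
    \<Rightarrow> 'g set \<Rightarrow> bool"
where
  "independence_set G X \<phi> k A J \<longleftrightarrow> J \<subseteq> carrier G \<and>
     (\<forall>I f. finite I \<and> I \<noteq> {} \<and> I \<subseteq> J \<and> f \<in> I \<rightarrow> {1..k} \<longrightarrow>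
        (\<Inter>s\<in>I. {x \<in> topspace X. \<phi> s x \<in> A (f s)}) \<noteq> {})"

definition independence_density_bound ::
  "('g, 'b) monoid_scheme \<Rightarrow> 'x topology \<Rightarrow> ('g \<Rightarrow> 'x \<Rightarrow> 'x) \<Rightarrow> nat \<Rightarrow> (nat \<Rightarrow> 'x set)
    \<Rightarrow> real \<Rightarrow> bool"
where
  "independence_density_bound G X \<phi> k A q \<longleftrightarrow> 0 \<le> q \<and>
     (\<forall>F. finite F \<and> F \<subseteq> carrier G \<longrightarrow>
        (\<exists>J\<subseteq>F. real (card J) \<ge> q * real (card F) \<and> independence_set G X \<phi> k A J))"

definition independence_density ::
  "('g, 'b) monoid_scheme \<Rightarrow> 'x topology \<Rightarrow> ('g \<Rightarrow> 'x \<Rightarrow> 'x) \<Rightarrow> nat \<Rightarrow> (nat \<Rightarrow> 'x set) \<Rightarrow> real"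
where
  "independence_density G X \<phi> k A = (GREATEST q. independence_density_bound G X \<phi> k A q)"

text \<open>The greatest such \<open>q\<close> exists, so \<^const>\<open>Greatest\<close> is not underspecified here.\<close>

lemma independence_density_greatest:
  assumes "carrier G \<noteq> {}"
  shows "independence_density_bound G X \<phi> k A (independence_density G X \<phi> k A)"
    and "independence_density_bound G X \<phi> k A q \<Longrightarrow> q \<le> independence_density G X \<phi> k A"
proof -
  let ?P = "independence_density_bound G X \<phi> k A"
  let ?S = "Collect ?P"
  have empty: "independence_set G X \<phi> k A {}"
    by (simp add: independence_set_def)
  have boundD: "\<exists>J\<subseteq>F. real (card J) \<ge> q * real (card F) \<and> independence_set G X \<phi> k A J"
    if "?P q" "finite F" "F \<subseteq> carrier G" for q F
    using that unfolding independence_density_bound_def by blast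
  have P0: "?P 0"
    unfolding independence_density_bound_def
    by (intro conjI allI impI exI[of _ "{}"]) (simp_all add: empty)
  have le1: "q \<le> 1" if P: "?P q" for q
  proof -
    obtain g where g: "g \<in> carrier G"
      using assms by blast
    then have "\<exists>J\<subseteq>{g}. real (card J) \<ge> q * real (card {g}) \<and> independence_set G X \<phi> k A J"
      by (intro boundD[OF P]) auto
    then obtain J where J: "J \<subseteq> {g}" "real (card J) \<ge> q * real (card {g})"
      by blast
    have "card J \<le> card {g}"
      using J by (intro card_mono) auto
    then show ?thesis
      using J by simp
  qed
  have bdd: "bdd_above ?S"
    using le1 by (auto intro!: bdd_aboveI[of _ 1])
  have "\<exists>J\<subseteq>F. real (card J) \<ge> Sup ?S * real (card F) \<and> independence_set G X \<phi> k A J"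
    if F: "finite F" "F \<subseteq> carrier G" for F
  proof (cases "F = {}")
    case True
    then show ?thesis
      using empty by (intro exI[of _ "{}"]) simp
  next
    case False
    then have pos: "0 < real (card F)"
      using F by (simp add: card_gt_0_iff)
    define T where "T = {J. J \<subseteq> F \<and> independence_set G X \<phi> k A J}"
    have T: "finite T" "{} \<in> T"
      using F empty by (simp_all add: T_def)
    obtain J where J: "J \<in> T" "\<And>J'. J' \<in> T \<Longrightarrow> card J' \<le> card J"
    proof -
      have "Max (card ` T) \<in> card ` T"
        using T by (intro Max_in) auto
      then obtain J where "J \<in> T" "card J = Max (card ` T)"
        by (metis imageE)
      then show ?thesis
        using T that by (metis Max_ge finite_imageI image_eqI)
    qed
    have "q \<le> real (card J) / real (card F)" if "q \<in> ?S" for q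
    proof -
      have "\<exists>J'\<subseteq>F. real (card J') \<ge> q * real (card F) \<and> independence_set G X \<phi> k A J'"
        using \<open>q \<in> ?S\<close> F by (intro boundD) simp_all
      then obtain J' where J': "J' \<in> T" "real (card J') \<ge> q * real (card F)"
        unfolding T_def by blast
      then have "q * real (card F) \<le> real (card J)"
        using J(2)[of J'] by linarith
      then show ?thesis
        using pos by (simp add: field_simps)
    qed
    then have "Sup ?S \<le> real (card J) / real (card F)"
      using P0 by (intro cSup_least) auto
    then have "Sup ?S * real (card F) \<le> real (card J)"
      using pos by (simp add: pos_le_divide_eq)
    then show ?thesis
      using J(1) unfolding T_def by blast
  qed
  moreover have "0 \<le> Sup ?S"
    using P0 bdd by (intro cSup_upper) auto
  ultimately have PS: "?P (Sup ?S)"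
    unfolding independence_density_bound_def[of _ _ _ _ _ "Sup ?S"] by blast
  have ub: "q \<le> Sup ?S" if "?P q" for q
    using that bdd by (intro cSup_upper) auto
  have "independence_density G X \<phi> k A = Sup ?S"
    unfolding independence_density_def using PS ub by (rule Greatest_equality)
  then show "?P (independence_density G X \<phi> k A)"
    and "?P q \<Longrightarrow> q \<le> independence_density G X \<phi> k A"
    using PS ub by simp_all
qed

definition IE ::
  "('g, 'b) monoid_scheme \<Rightarrow> 'x topology \<Rightarrow> ('g \<Rightarrow> 'x \<Rightarrow> 'x) \<Rightarrow> nat \<Rightarrow> (nat \<Rightarrow> 'x) set"
where
  "IE G X \<phi> k =
     {x \<in> {1..k} \<rightarrow>\<^sub>E topspace X.
        \<forall>U. (\<forall>i\<in>{1..k}. openin X (U i) \<and> x i \<in> U i) \<longrightarrow> independence_density G X \<phi> k U > 0}"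

end

theory Submission
  imports Defs
begin

text \<open>
  Let \<open>U\<^sub>1, \<dots>, U\<^sub>k\<close> be small neighbourhoods of the coordinates of an IE-tuple, and let \<open>J\<close> be an
  independence set of size at least \<open>q|A|\<close> inside a Folner set \<open>A\<close>. Each of the \<open>k\<^bsup>|J|\<^esup>\<close> functions
  \<open>f : J \<rightarrow> {1, \<dots>, k}\<close> is realised by a point \<open>y\<^sub>f\<close>. Up to \<open>\<delta>\<close>, these points show at most
  \<open>N\<^bsup>|FA - A|\<^esup>\<close> patterns on the boundary \<open>FA - A\<close>; since the boundary is small, that number is less
  than \<open>(k / (k - 1))\<^bsup>|J|\<^esup>\<close>. Hence some class of functions with equal pattern takes all \<open>k\<close>
  values at one \<open>s \<in> J\<close>. The Markov property glues the corresponding \<open>k\<close> points inside \<open>A\<close> to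
  a common point outside \<open>A\<close>; the glued points, translated by \<open>s\<close>, lie near the given tuple and,
  by expansivity, are asymptotic.
\<close>

lemma (in Metric_space) tendsto_mdist:
  assumes "limitin mtopology a l sequentially" and "limitin mtopology b m sequentially"
  shows "(\<lambda>n. d (a n) (b n)) \<longlonglongrightarrow> d l m"
proof (rule tendstoI)
  fix e :: real
  assume "0 < e"
  then have "\<forall>\<^sub>F n in sequentially. a n \<in> M \<and> d (a n) l < e / 2"
    and "\<forall>\<^sub>F n in sequentially. b n \<in> M \<and> d (b n) m < e / 2"
    using assms half_gt_zero unfolding limitin_metric by blast+
  then show "\<forall>\<^sub>F n in sequentially. dist (d (a n) (b n)) (d l m) < e"
  proof eventually_elim
    case (elim n)
    have "l \<in> M" "m \<in> M"
      using assms by (auto simp: limitin_metric)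
    then have "\<bar>d (a n) (b n) - d l m\<bar> \<le> d (a n) l + d (b n) m"
      using elim triangle[of "a n" l "b n"] triangle[of l m "b n"]
        triangle[of l "a n" m] triangle[of "a n" "b n" m]
        commute[of l "a n"] commute[of m "b n"]
      by linarith
    then show ?case
      using elim by (simp add: dist_real_def)
  qed
qed

text \<open>A compact metric space is bounded, so the set under \<open>Sup\<close> is bounded above
  even for infinite \<open>K\<close>. The conjunct \<open>0 \<le> e\<close> comes from the inserted
  \<open>0\<close> and carries content only when \<open>K\<close> is empty.\<close>

lemma (in Metric_space) sup_dist_le_iff:
  assumes "compact_space mtopology"
    and "\<And>g. g \<in> K \<Longrightarrow> \<phi> g x \<in> M \<and> \<phi> g y \<in> M"
  shows "sup_dist d \<phi> K x y \<le> e \<longleftrightarrow> 0 \<le> e \<and> (\<forall>g\<in>K. d (\<phi> g x) (\<phi> g y) \<le> e)"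
proof -
  have "mbounded M"
    using assms(1) by (simp add: compactin_imp_mbounded compact_space_def)
  then obtain B where "\<forall>x\<in>M. \<forall>y\<in>M. d x y \<le> B"
    unfolding mbounded_alt by blast
  then have "bdd_above (insert 0 ((\<lambda>g. d (\<phi> g x) (\<phi> g y)) ` K))"
    using assms(2) by (auto intro!: bdd_aboveI[of _ "max 0 B"] simp: le_max_iff_disj)
  then show ?thesis
    unfolding sup_dist_def by (subst cSup_le_iff) auto
qed

text \<open>
  If infinitely many translates of the pair stayed \<open>\<eta>\<close>-apart, a limit of them would be a pair of
  distinct points whose whole orbit stays \<open>c\<close>-close, against expansivity.
\<close>

lemma (in Metric_space) expansive_asymptotic:
  assumes act: "group_action G M \<phi>"
    and compact: "compact_space mtopology"
    and cont: "\<And>g. g \<in> carrier G \<Longrightarrow> continuous_map mtopology mtopology (\<phi> g)"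
    and expansive: "\<And>x y. x \<in> M \<Longrightarrow> y \<in> M \<Longrightarrow> x \<noteq> y \<Longrightarrow>
      \<exists>g\<in>carrier G. d (\<phi> g x) (\<phi> g y) > c"
    and xy: "x \<in> M" "y \<in> M"
    and A: "finite A" "\<And>g. g \<in> carrier G - A \<Longrightarrow> d (\<phi> g x) (\<phi> g y) \<le> c"
    and \<eta>: "0 < \<eta>"
  shows "finite {g \<in> carrier G. d (\<phi> g x) (\<phi> g y) > \<eta>}" (is "finite ?S")
proof (rule ccontr)
  interpret group_action G M \<phi> by (rule act)
  interpret group G by (rule group_hom.axioms(1)[OF group_hom])
  assume "infinite ?S"
  then obtain g :: "nat \<Rightarrow> _" where g: "inj g" "range g \<subseteq> ?S"
    using infinite_countable_subset by blast
  have gG: "g n \<in> carrier G" for n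
    using g(2) by blast
  have in_M: "\<phi> h z \<in> M" if "h \<in> carrier G" "z \<in> M" for h z
    using element_image that by blast
  have "range (\<lambda>n. \<phi> (g n) x) \<subseteq> M"
    using in_M gG xy by blast
  then obtain a r where r: "strict_mono r" "a \<in> M"
    and a: "limitin mtopology ((\<lambda>n. \<phi> (g n) x) \<circ> r) a sequentially"
    using compact unfolding compact_space_sequentially by blast
  have "range (\<lambda>n. \<phi> (g (r n)) y) \<subseteq> M"
    using in_M gG xy by blast
  then obtain b r' where r': "strict_mono r'" "b \<in> M"
    and b: "limitin mtopology ((\<lambda>n. \<phi> (g (r n)) y) \<circ> r') b sequentially"
    using compact unfolding compact_space_sequentially by blast
  \<comment> \<open>The second extraction was made inside the first, so both coordinates converge
    along \<open>u\<close>.\<close>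
  define u where "u n = g (r (r' n))" for n
  have uG: "u n \<in> carrier G" for n
    using gG by (simp add: u_def)
  have "inj u"
    using g(1) r(1) r'(1) unfolding u_def inj_def by (metis strict_mono_eq)
  have ux: "limitin mtopology (\<lambda>n. \<phi> (u n) x) a sequentially"
    using limitin_subsequence[OF r'(1) a] by (simp add: o_def u_def)
  have uy: "limitin mtopology (\<lambda>n. \<phi> (u n) y) b sequentially"
    using b by (simp add: o_def u_def)
  have "\<eta> \<le> d a b"
  proof (rule tendsto_lowerbound[OF tendsto_mdist[OF ux uy]])
    have "\<eta> < d (\<phi> (u n) x) (\<phi> (u n) y)" for n
      using g(2) unfolding u_def by blast
    then show "\<forall>\<^sub>F n in sequentially. \<eta> \<le> d (\<phi> (u n) x) (\<phi> (u n) y)"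
      by (intro always_eventually) (simp add: less_imp_le)
  qed simp
  then have "a \<noteq> b"
    using \<eta> r(2) by auto
  moreover have "d (\<phi> h a) (\<phi> h b) \<le> c" if h: "h \<in> carrier G" for h
  proof (rule tendsto_upperbound[OF tendsto_mdist])
    show "limitin mtopology (\<phi> h \<circ> (\<lambda>n. \<phi> (u n) x)) (\<phi> h a) sequentially"
      "limitin mtopology (\<phi> h \<circ> (\<lambda>n. \<phi> (u n) y)) (\<phi> h b) sequentially"
      by (rule continuous_map_limit[OF cont[OF h] ux], rule continuous_map_limit[OF cont[OF h] uy])
    \<comment> \<open>For fixed \<open>h\<close> the products of \<open>h\<close> with the
      \<open>u n\<close> are pairwise distinct, so only finitely many lie in the finite set
      \<open>A\<close>. From then on the pair is \<open>c\<close>-close, and the limit inherits this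
      bound.\<close>
    have "inj (\<lambda>n. h \<otimes>\<^bsub>G\<^esub> u n)"
      using \<open>inj u\<close> h uG by (simp add: inj_def)
    then have "finite ((\<lambda>n. h \<otimes>\<^bsub>G\<^esub> u n) -` A)"
      using A(1) by (simp add: finite_vimageI)
    then have "\<forall>\<^sub>F n in sequentially. n \<notin> (\<lambda>n. h \<otimes>\<^bsub>G\<^esub> u n) -` A"
      unfolding cofinite_eq_sequentially[symmetric] eventually_cofinite
      by (simp add: vimage_def)
    then show "\<forall>\<^sub>F n in sequentially.
        d ((\<phi> h \<circ> (\<lambda>n. \<phi> (u n) x)) n) ((\<phi> h \<circ> (\<lambda>n. \<phi> (u n) y)) n) \<le> c"
    proof eventually_elim
      case (elim n)
      then have "d (\<phi> (h \<otimes>\<^bsub>G\<^esub> u n) x) (\<phi> (h \<otimes>\<^bsub>G\<^esub> u n) y) \<le> c"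
        using A(2) h uG by auto
      then show ?case
        by (simp add: composition_rule xy h uG)
    qed
  qed simp
  ultimately show False
    using expansive[of a b] r(2) r'(2) by fastforce
qed

text \<open>
  A fibre of \<open>p\<close> that misses some value at every coordinate has at most \<open>(k - 1)\<^bsup>|J|\<^esup>\<close> elements.
\<close>

lemma fibre_with_full_coordinate:
  fixes J :: "'a set" and p :: "('a \<Rightarrow> nat) \<Rightarrow> 'b"
  assumes J: "finite J" and P: "finite P" and p: "p \<in> (J \<rightarrow>\<^sub>E {1..k}) \<rightarrow> P"
    and less: "card P * (k - 1) ^ card J < k ^ card J"
  shows "\<exists>s\<in>J. \<exists>w. {1..k} \<subseteq> (\<lambda>f. f s) ` {f \<in> J \<rightarrow>\<^sub>E {1..k}. p f = w}"
    (is ?full)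
proof (rule ccontr)
  define fib where "fib w = {f \<in> J \<rightarrow>\<^sub>E {1..k}. p f = w}" for w
  assume not_full: "\<not> ?full"
  have "\<not> {1..k} \<subseteq> (\<lambda>f. f s) ` fib w" if "s \<in> J" for s w
  proof
    assume "{1..k} \<subseteq> (\<lambda>f. f s) ` fib w"
    then have ?full
      unfolding fib_def by (rule bexI[OF exI[of _ w] that])
    with not_full show False ..
  qed
  then have missed: "\<forall>s\<in>J. \<exists>i. i \<in> {1..k} - (\<lambda>f. f s) ` fib w" for w
    unfolding ex_in_conv Diff_eq_empty_iff by (rule ballI)
  have card_fib: "card (fib w) \<le> (k - 1) ^ card J" for w
  proof -
    from bchoice[OF missed[of w]]
    obtain m where m: "\<forall>s\<in>J. m s \<in> {1..k} - (\<lambda>f. f s) ` fib w" ..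
    have "fib w \<subseteq> (\<Pi>\<^sub>E s\<in>J. {1..k} - {m s})"
    proof (intro subsetI PiE_I)
      fix f s
      assume f: "f \<in> fib w"
      then have "f \<in> J \<rightarrow>\<^sub>E {1..k}"
        by (simp add: fib_def)
      then show "s \<notin> J \<Longrightarrow> f s = undefined"
        by (rule PiE_arb)
      assume "s \<in> J"
      have "f s \<in> (\<lambda>f. f s) ` fib w"
        using f by (rule imageI)
      with bspec[OF m \<open>s \<in> J\<close>] have "m s \<noteq> f s"
        by auto
      then show "f s \<in> {1..k} - {m s}"
        using PiE_mem[OF \<open>f \<in> J \<rightarrow>\<^sub>E {1..k}\<close> \<open>s \<in> J\<close>] by simp
    qed
    then have "card (fib w) \<le> card (\<Pi>\<^sub>E s\<in>J. {1..k} - {m s})"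
      by (rule card_mono[rotated]) (simp add: J finite_PiE)
    also have "\<dots> = (\<Prod>s\<in>J. card ({1..k} - {m s}))"
      using J by (rule card_PiE)
    also have "\<dots> = (\<Prod>s\<in>J. k - 1)"
    proof (rule prod.cong[OF refl])
      fix s
      assume "s \<in> J"
      from bspec[OF m this] have "m s \<in> {1..k}"
        by (rule DiffD1)
      then show "card ({1..k} - {m s}) = k - 1"
        by simp
    qed
    finally show ?thesis
      by simp
  qed
  \<comment> \<open>The fibres over \<open>P\<close> cover all functions, so the bound on each fibre
    contradicts \<open>less\<close>.\<close>
  have "k ^ card J = card (J \<rightarrow>\<^sub>E {1..k})"
    using J by (simp add: card_PiE)
  also have "(J \<rightarrow>\<^sub>E {1..k}) = (\<Union>w\<in>P. fib w)"
    using p unfolding fib_def by blast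
  also have "card \<dots> \<le> (\<Sum>w\<in>P. card (fib w))"
    by (rule card_UN_le[OF P])
  also have "\<dots> \<le> card P * (k - 1) ^ card J"
    using sum_bounded_above[of P "\<lambda>w. card (fib w)"] card_fib by simp
  finally show False
    using less by simp
qed

text \<open>Each boundary element lies in some translate of \<open>A\<close> by an
  \<open>s \<in> F\<close> but not in \<open>A\<close>. So \<open>card F\<close> symmetric
  differences cover the boundary, and the Folner condition makes each of them small.\<close>

lemma amenable_small_boundary:
  assumes "group G" "amenable G" and F: "finite F" "F \<subseteq> carrier G" and "0 < \<eta>"
  obtains A where "finite A" "A \<noteq> {}" "A \<subseteq> carrier G"
    "real (card ((F <#>\<^bsub>G\<^esub> A) - A)) \<le> \<eta> * real (card A)"
proof -
  \<comment> \<open>The tolerance is shared among the elements of \<open>F\<close>; the added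
    \<open>1\<close> keeps the denominator positive when \<open>F\<close> is empty.\<close>
  define \<epsilon> where "\<epsilon> = \<eta> / (real (card F) + 1)"
  have "0 < \<epsilon>"
    using \<open>0 < \<eta>\<close> by (simp add: \<epsilon>_def add_nonneg_pos)
  then obtain A where A: "finite A" "A \<noteq> {}" "A \<subseteq> carrier G"
    and folner: "\<And>s. s \<in> F \<Longrightarrow> real (card (sym_diff (s <#\<^bsub>G\<^esub> A) A)) \<le> \<epsilon> * real (card A)"
    using \<open>amenable G\<close> F unfolding amenable_def by metis
  have fin: "finite (sym_diff (s <#\<^bsub>G\<^esub> A) A)" for s
    using A(1) by (simp add: l_coset_def)
  have "(F <#>\<^bsub>G\<^esub> A) - A \<subseteq> (\<Union>s\<in>F. sym_diff (s <#\<^bsub>G\<^esub> A) A)"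
    by (auto simp: set_mult_def l_coset_def)
  then have "card ((F <#>\<^bsub>G\<^esub> A) - A) \<le> card (\<Union>s\<in>F. sym_diff (s <#\<^bsub>G\<^esub> A) A)"
    by (intro card_mono finite_UN_I F(1) fin)
  also have "\<dots> \<le> (\<Sum>s\<in>F. card (sym_diff (s <#\<^bsub>G\<^esub> A) A))"
    by (rule card_UN_le[OF F(1)])
  finally have "real (card ((F <#>\<^bsub>G\<^esub> A) - A)) \<le> (\<Sum>s\<in>F. real (card (sym_diff (s <#\<^bsub>G\<^esub> A) A)))"
    by (simp only: of_nat_sum[symmetric] of_nat_le_iff)
  also have "\<dots> \<le> real (card F) * (\<epsilon> * real (card A))"
    using folner by (rule sum_bounded_above)
  also have "\<dots> \<le> \<eta> * real (card A)"
  proof -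
    have "real (card F) * \<epsilon> \<le> \<eta>"
      using \<open>0 < \<eta>\<close> by (simp add: \<epsilon>_def field_simps)
    then show ?thesis
      by (simp add: mult_right_mono mult.assoc[symmetric])
  qed
  finally show ?thesis
    using A that by blast
qed

text \<open>After taking logarithms the claim becomes
  \<open>b * ln N < j * ln (k / (k - 1))\<close>. In the application \<open>N\<close> counts cells,
  \<open>b\<close> is the size of the boundary, \<open>a\<close> that of the Folner set and
  \<open>j\<close> that of the independence set.\<close>

lemma power_mult_power_less:
  fixes N k a b j :: nat and q :: real
  assumes "N > 0" "k \<ge> 2" "0 < a"
    and b: "real b \<le> q * ln (real k / (real k - 1)) / (ln (real N) + 1) * real a" and j: "q * real a \<le> real j" and "0 < q"
  shows "N ^ b * (k - 1) ^ j < k ^ j"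
proof -
  let ?L = "ln (real k / (real k - 1))"
  have L: "0 < ?L"
    using \<open>k \<ge> 2\<close> by simp
  have N: "0 \<le> ln (real N)"
    using \<open>N > 0\<close> by simp
  have "real b * ln N \<le> q * ?L / (ln N + 1) * a * ln N"
    using b N by (rule mult_right_mono)
  also have "\<dots> = q * a * ?L * (ln N / (ln N + 1))"
    by simp
  \<comment> \<open>Strictness comes from \<open>ln N / (ln N + 1) < 1\<close>. The added
    \<open>1\<close> also covers \<open>N = 1\<close>, where \<open>ln N\<close> vanishes.\<close>
  also have "\<dots> < q * a * ?L * 1"
    using L N \<open>0 < q\<close> \<open>0 < a\<close> by (intro mult_strict_left_mono) (auto simp: divide_less_eq)
  also have "\<dots> \<le> real j * ?L"
    using j L by (simp add: mult_right_mono)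
  finally have "real b * ln N + real j * ln (real k - 1) < real j * ln k"
    using \<open>k \<ge> 2\<close> by (simp add: ln_div algebra_simps)
  then have "ln (real N ^ b * (real k - 1) ^ j) < ln (real k ^ j)"
    using \<open>k \<ge> 2\<close> \<open>N > 0\<close> by (simp add: ln_mult ln_realpow)
  then have "real N ^ b * (real k - 1) ^ j < real k ^ j"
    using \<open>k \<ge> 2\<close> \<open>N > 0\<close> by (subst (asm) ln_less_cancel_iff) auto
  then have "real (N ^ b * (k - 1) ^ j) < real (k ^ j)"
    using \<open>k \<ge> 2\<close> by (simp add: of_nat_diff)
  then show ?thesis
    by (simp only: of_nat_less_iff)
qed

theorem theorem6p9:
  fixes G :: "('g, 'b) monoid_scheme"
    and X :: "'x topology"
    and d :: "'x \<Rightarrow> 'x \<Rightarrow> real"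
    and \<phi> :: "'g \<Rightarrow> 'x \<Rightarrow> 'x"
    and k :: nat
  assumes "group G"
    and "countable (carrier G)" and "infinite (carrier G)"
    and "amenable G"
    and "compact_space X"
    and "Metric_space (topspace X) d" and "Metric_space.mtopology (topspace X) d = X"
    and "group_action G (topspace X) \<phi>"
    and "\<And>g. g \<in> carrier G \<Longrightarrow> homeomorphic_map X X (\<phi> g)"
    and "expansive G X d \<phi>"
    and "strong_topological_Markov_property G X d \<phi>"
    and "k \<ge> 2"
  shows "IE G X \<phi> k \<subseteq>
           (product_topology (\<lambda>_. X) {1..k}) closure_of (asymptotic_tuples G X d \<phi> k)"
proof
  interpret Metric_space "topspace X" d by fact
  interpret group_action G "topspace X" \<phi> by fact
  interpret group G by fact
  have mtop: "mtopology = X" and compact: "compact_space mtopology"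
    using assms by simp_all
  have cont: "continuous_map mtopology mtopology (\<phi> g)" if "g \<in> carrier G" for g
    using assms(9)[OF that] by (simp add: mtop homeomorphic_imp_continuous_map)
  have in_X: "\<phi> g z \<in> topspace X" if "g \<in> carrier G" "z \<in> topspace X" for g z
    using element_image that by blast
  have sup_le: "sup_dist d \<phi> K x y \<le> e \<longleftrightarrow> 0 \<le> e \<and> (\<forall>g\<in>K. d (\<phi> g x) (\<phi> g y) \<le> e)"
    if "K \<subseteq> carrier G" "x \<in> topspace X" "y \<in> topspace X" for K x y e
    using that in_X by (intro sup_dist_le_iff compact) blast
  obtain c where "0 < c" and c: "\<And>x y. x \<in> topspace X \<Longrightarrow> y \<in> topspace X \<Longrightarrow> x \<noteq> y \<Longrightarrow>
      \<exists>g\<in>carrier G. d (\<phi> g x) (\<phi> g y) > c"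
    using assms(10) unfolding expansive_def by blast
  fix x
  assume "x \<in> IE G X \<phi> k"
  then have x: "x \<in> {1..k} \<rightarrow>\<^sub>E topspace X"
    and density: "\<And>U. (\<And>i. i \<in> {1..k} \<Longrightarrow> openin X (U i) \<and> x i \<in> U i) \<Longrightarrow>
      independence_density G X \<phi> k U > 0"
    unfolding IE_def by blast+
  have "\<exists>z \<in> asymptotic_tuples G X d \<phi> k. z \<in> W"
    if W: "x \<in> W" "openin (product_topology (\<lambda>_. X) {1..k}) W" for W
  proof -

    \<comment> \<open>Choice of the neighbourhoods and of the scale\<close>
    obtain V where V: "\<And>i. i \<in> {1..k} \<Longrightarrow> openin X (V i)" "x \<in> Pi\<^sub>E {1..k} V" "Pi\<^sub>E {1..k} V \<subseteq> W"
      using W unfolding openin_product_topology_alt by meson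
    have "\<exists>r>0. mball (x i) r \<subseteq> V i" if "i \<in> {1..k}" for i
      using V(1,2) that openin_mtopology[of "V i"] unfolding mtop by blast
    then obtain r where r: "\<And>i. i \<in> {1..k} \<Longrightarrow> 0 < r i \<and> mball (x i) (r i) \<subseteq> V i"
      by metis
    \<comment> \<open>The bound by each \<open>r i\<close> keeps points at distance below
      \<open>\<rho>\<close> from \<open>x i\<close> inside \<open>V i\<close>; the bound by
      \<open>c\<close> lets expansivity act on points that are \<open>\<rho>\<close>-close. Half of
      \<open>\<rho>\<close> is spent on \<open>U\<close>, the other half on gluing.\<close>
    define \<rho> where "\<rho> = Min (insert c (r ` {1..k}))"
    have \<rho>: "0 < \<rho>" "\<rho> \<le> c"
      using r \<open>0 < c\<close> unfolding \<rho>_def by (auto intro: Min_le)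
    have \<rho>_le: "\<rho> \<le> r i" if "i \<in> {1..k}" for i
      using that unfolding \<rho>_def by (intro Min_le) auto
    define U where "U i = mball (x i) (\<rho> / 2)" for i
    have "openin X (U i) \<and> x i \<in> U i" if "i \<in> {1..k}" for i
    proof
      show "openin X (U i)"
        using openin_mball[of "x i" "\<rho> / 2"] by (simp add: U_def mtop)
      have "x i \<in> topspace X"
        using x that by (rule PiE_mem)
      then show "x i \<in> U i"
        using \<rho>(1) by (simp add: U_def)
    qed
    then have "0 < independence_density G X \<phi> k U"
      by (rule density)
    moreover define q where "q = independence_density G X \<phi> k U"
    ultimately have "0 < q" and q: "independence_density_bound G X \<phi> k U q"
      using independence_density_greatest(1)[of G X \<phi> k U] by auto
    have "0 < \<rho> / 2"
      using \<rho>(1) by simp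

    \<comment> \<open>Markov window, cells and Folner set\<close>
    from assms(11)[unfolded strong_topological_Markov_property_def, THEN spec, THEN mp, OF this]
    obtain \<delta> F where "0 < \<delta>" and F: "finite F" "F \<subseteq> carrier G" "\<one>\<^bsub>G\<^esub> \<in> F"
      and memory: "\<forall>A. finite A \<and> A \<subseteq> carrier G \<longrightarrow>
        memory_set G X d \<phi> (\<rho> / 2) \<delta> A (F <#>\<^bsub>G\<^esub> A)"
      by (elim exE conjE)
    \<comment> \<open>Radius \<open>\<delta> / 2\<close> makes any two points with the same cell
      centre \<open>\<delta>\<close>-close, as the memory set property demands.\<close>
    have "mtotally_bounded (topspace X)" "0 < \<delta> / 2"
      using compact \<open>0 < \<delta>\<close> by (simp_all add: compact_space_eq_mcomplete_mtotally_bounded)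
    then obtain C where C: "finite C" "C \<subseteq> topspace X" "topspace X \<subseteq> (\<Union>z\<in>C. mball z (\<delta> / 2))"
      unfolding mtotally_bounded_def by meson
    then have "\<forall>y\<in>topspace X. \<exists>z. z \<in> C \<and> z \<in> topspace X \<and> d z y < \<delta> / 2"
      using in_mball by blast
    from bchoice[OF this] obtain cell
      where cell_all: "\<forall>y\<in>topspace X. cell y \<in> C \<and> cell y \<in> topspace X \<and> d (cell y) y < \<delta> / 2" ..
    note cell = bspec[OF cell_all]
    have "x 1 \<in> topspace X"
      using x \<open>k \<ge> 2\<close> by auto
    then have "C \<noteq> {}"
      using cell by blast
    \<comment> \<open>This is the boundary ratio at which \<open>power_mult_power_less\<close>
      applies with \<open>N = card C\<close>.\<close>
    let ?\<eta> = "q * ln (real k / (real k - 1)) / (ln (card C) + 1)"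
    have "card C > 0"
      using C \<open>C \<noteq> {}\<close> by (simp add: card_gt_0_iff)
    have "0 < ?\<eta>"
      using \<open>0 < q\<close> \<open>k \<ge> 2\<close> \<open>card C > 0\<close> by (intro divide_pos_pos mult_pos_pos add_nonneg_pos) auto
    then obtain A where A: "finite A" "A \<noteq> {}" "A \<subseteq> carrier G"
      and boundary: "real (card ((F <#>\<^bsub>G\<^esub> A) - A)) \<le> ?\<eta> * real (card A)"
      using amenable_small_boundary[OF \<open>group G\<close> \<open>amenable G\<close> F(1,2)] by metis
    let ?B = "F <#>\<^bsub>G\<^esub> A"
    have B: "finite ?B" "?B \<subseteq> carrier G" "A \<subseteq> ?B"
    proof -
      have "?B = (\<lambda>(f, a). f \<otimes>\<^bsub>G\<^esub> a) ` (F \<times> A)"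
        by (auto simp: set_mult_def)
      then show "finite ?B"
        using F(1) A(1) by simp
      show "?B \<subseteq> carrier G"
        using set_mult_closed F(2) A(3) by blast
      have "a = \<one>\<^bsub>G\<^esub> \<otimes>\<^bsub>G\<^esub> a" if "a \<in> A" for a
        using A(3) that by auto
      then show "A \<subseteq> ?B"
        using F(3) unfolding set_mult_def by blast
    qed
    obtain J where J: "J \<subseteq> A" "real (card J) \<ge> q * real (card A)" "independence_set G X \<phi> k U J"
      using q A unfolding independence_density_bound_def by blast
    have "finite J"
      using J(1) A(1) finite_subset by blast
    have "card A > 0"
      using A by (simp add: card_gt_0_iff)
    then have "0 < q * real (card A)"
      using \<open>0 < q\<close> by simp
    \<comment> \<open>Independence speaks only of nonempty index sets, so this is what allows the
      choice \<open>I = J\<close>.\<close>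
    then have "J \<noteq> {}"
      using J(2) by auto

    \<comment> \<open>Counting boundary patterns\<close>
    have "\<forall>f \<in> J \<rightarrow>\<^sub>E {1..k}. \<exists>y. y \<in> topspace X \<and> (\<forall>s\<in>J. \<phi> s y \<in> U (f s))"
    proof
      fix f
      assume "f \<in> J \<rightarrow>\<^sub>E {1..k}"
      then have "f \<in> J \<rightarrow> {1..k}"
        by (simp add: PiE_def)
      then have "(\<Inter>s\<in>J. {y \<in> topspace X. \<phi> s y \<in> U (f s)}) \<noteq> {}"
        using J(3) \<open>finite J\<close> \<open>J \<noteq> {}\<close> unfolding independence_set_def by blast
      then show "\<exists>y. y \<in> topspace X \<and> (\<forall>s\<in>J. \<phi> s y \<in> U (f s))"
        using \<open>J \<noteq> {}\<close> by blast
    qed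
    from bchoice[OF this] obtain y
      where y_all: "\<forall>f \<in> J \<rightarrow>\<^sub>E {1..k}. y f \<in> topspace X \<and> (\<forall>s\<in>J. \<phi> s (y f) \<in> U (f s))" ..
    note y = bspec[OF y_all]
    \<comment> \<open>The pattern of \<open>f\<close> records the cells that the orbit of
      \<open>y f\<close> meets along the boundary. Restriction makes it an element of
      \<open>(?B - A) \<rightarrow>\<^sub>E C\<close>, a set of size
      \<open>card C ^ card (?B - A)\<close>.\<close>
    define p where "p f = restrict (\<lambda>b. cell (\<phi> b (y f))) (?B - A)" for f
    have "\<exists>s\<in>J. \<exists>w. {1..k} \<subseteq> (\<lambda>f. f s) ` {f \<in> J \<rightarrow>\<^sub>E {1..k}. p f = w}"
    proof (rule fibre_with_full_coordinate[OF \<open>finite J\<close>])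
      show "finite ((?B - A) \<rightarrow>\<^sub>E C)"
        using B(1) C(1) by (simp add: finite_PiE)
      show "p \<in> (J \<rightarrow>\<^sub>E {1..k}) \<rightarrow> ((?B - A) \<rightarrow>\<^sub>E C)"
        using B(2) y cell in_X unfolding p_def by (intro Pi_I restrict_PiE_iff[THEN iffD2] ballI) (meson DiffD1 subsetD)
      show "card ((?B - A) \<rightarrow>\<^sub>E C) * (k - 1) ^ card J < k ^ card J"
        unfolding card_funcsetE[OF finite_Diff[OF B(1)]]
        by (rule power_mult_power_less[OF \<open>card C > 0\<close> \<open>k \<ge> 2\<close> \<open>card A > 0\<close> boundary J(2) \<open>0 < q\<close>])
    qed
    then obtain s w where s: "s \<in> J"
      and full: "{1..k} \<subseteq> (\<lambda>f. f s) ` {f \<in> J \<rightarrow>\<^sub>E {1..k}. p f = w}"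
      by auto
    have "\<forall>i\<in>{1..k}. \<exists>f. f \<in> J \<rightarrow>\<^sub>E {1..k} \<and> f s = i \<and> p f = w"
    proof
      fix i
      assume "i \<in> {1..k}"
      with full have "i \<in> (\<lambda>f. f s) ` {f \<in> J \<rightarrow>\<^sub>E {1..k}. p f = w}" ..
      then obtain g where "i = g s" "g \<in> {f \<in> J \<rightarrow>\<^sub>E {1..k}. p f = w}"
        by (rule imageE)
      then show "\<exists>f. f \<in> J \<rightarrow>\<^sub>E {1..k} \<and> f s = i \<and> p f = w"
        by (intro exI[of _ g]) simp
    qed
    from bchoice[OF this] obtain f
      where f_all: "\<forall>i\<in>{1..k}. f i \<in> J \<rightarrow>\<^sub>E {1..k} \<and> f i s = i \<and> p (f i) = w" ..
    have f: "f i \<in> J \<rightarrow>\<^sub>E {1..k}" "f i s = i" "p (f i) = w" if "i \<in> {1..k}" for i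
      using bspec[OF f_all that] by simp_all

    \<comment> \<open>Gluing to a common exterior\<close>
    have sA: "s \<in> A" "s \<in> carrier G"
      using s J(1) A(3) by auto
    have fX: "y (f i) \<in> topspace X" if "i \<in> {1..k}" for i
      using y[OF f(1)[OF that]] ..
    have k1: "1 \<in> {1..k}"
      using \<open>k \<ge> 2\<close> by simp
    \<comment> \<open>The index \<open>1\<close> is an arbitrary choice: \<open>y (f 1)\<close>
      guides every glued point outside \<open>A\<close>, while \<open>y (f i)\<close> guides the
      \<open>i\<close>-th one on \<open>?B\<close>, in particular at \<open>s\<close>.\<close>
    have "\<forall>i\<in>{1..k}. \<exists>z. z \<in> topspace X \<and> (\<forall>g\<in>?B. d (\<phi> g (y (f i))) (\<phi> g z) \<le> \<rho> / 2) \<and>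
        (\<forall>g\<in>carrier G - A. d (\<phi> g (y (f 1))) (\<phi> g z) \<le> \<rho> / 2)" (is "\<forall>i\<in>_. \<exists>z. ?glued i z")
    proof
      fix i
      assume i: "i \<in> {1..k}"
      have "d (\<phi> b (y (f i))) (\<phi> b (y (f 1))) \<le> \<delta>" if b: "b \<in> ?B - A" for b
      proof -
        have "b \<in> carrier G"
          using b B(2) by blast
        have "p (f i) b = p (f 1) b"
          by (simp only: f(3)[OF i] f(3)[OF k1])
        then have "cell (\<phi> b (y (f i))) = cell (\<phi> b (y (f 1)))"
          using b by (simp add: p_def)
        then show ?thesis
          using cell[OF in_X[OF \<open>b \<in> carrier G\<close> fX[OF i]]] cell[OF in_X[OF \<open>b \<in> carrier G\<close> fX[OF k1]]]
            triangle[of "\<phi> b (y (f i))" "cell (\<phi> b (y (f i)))" "\<phi> b (y (f 1))"]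
            in_X[OF \<open>b \<in> carrier G\<close> fX[OF i]] in_X[OF \<open>b \<in> carrier G\<close> fX[OF k1]]
            commute[of "\<phi> b (y (f i))" "cell (\<phi> b (y (f i)))"]
          by simp
      qed
      then have "sup_dist d \<phi> (?B - A) (y (f i)) (y (f 1)) \<le> \<delta>"
        using sup_le[of "?B - A" "y (f i)" "y (f 1)" \<delta>] B(2) fX[OF i] fX[OF k1] \<open>0 < \<delta>\<close> by auto
      moreover have "memory_set G X d \<phi> (\<rho> / 2) \<delta> A ?B"
        using memory A(1,3) by simp
      ultimately obtain z where glued: "z \<in> topspace X" "sup_dist d \<phi> ?B (y (f i)) z \<le> \<rho> / 2"
        "sup_dist d \<phi> (carrier G - A) (y (f 1)) z \<le> \<rho> / 2"
        using fX[OF i] fX[OF k1] unfolding memory_set_def by meson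
      then have "?glued i z"
        using glued(1) sup_le[OF B(2) fX[OF i] glued(1), THEN iffD1, OF glued(2)]
          sup_le[OF Diff_subset fX[OF k1] glued(1), THEN iffD1, OF glued(3)]
        by blast
      then show "\<exists>z. ?glued i z" ..
    qed
    from bchoice[OF this] obtain z where z_all: "\<forall>i\<in>{1..k}. ?glued i (z i)" ..
    have z: "z i \<in> topspace X"
      and z_in: "g \<in> ?B \<Longrightarrow> d (\<phi> g (y (f i))) (\<phi> g (z i)) \<le> \<rho> / 2"
      and z_out: "g \<in> carrier G - A \<Longrightarrow> d (\<phi> g (y (f 1))) (\<phi> g (z i)) \<le> \<rho> / 2"
      if "i \<in> {1..k}" for i g
      using bspec[OF z_all that] by simp_all
    \<comment> \<open>Only at \<open>s\<close> is \<open>y (f i)\<close> known to visit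
      \<open>U i\<close>, hence the translation by \<open>s\<close>. The restriction supplies the
      value \<open>undefined\<close> off \<open>{1..k}\<close>.\<close>
    define t where "t = restrict (\<lambda>i. \<phi> s (z i)) {1..k}"
    have tX: "t i \<in> topspace X" if "i \<in> {1..k}" for i
      using that z in_X[OF sA(2)] by (simp add: t_def)

    \<comment> \<open>Asymptoticity of the translated tuple\<close>
    have t_close: "d (\<phi> g (t i)) (\<phi> g (t j)) \<le> c"
      if "i \<in> {1..k}" "j \<in> {1..k}" "g \<in> carrier G - (\<lambda>a. a \<otimes>\<^bsub>G\<^esub> inv\<^bsub>G\<^esub> s) ` A" for i j g
    proof -
      \<comment> \<open>Moving \<open>t i\<close> by \<open>g\<close> moves \<open>z i\<close> by
        the product of \<open>g\<close> and \<open>s\<close>, which must avoid \<open>A\<close>. The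
        exceptional set is therefore \<open>A\<close> multiplied on the right by the inverse of
        \<open>s\<close>.\<close>
      have g: "g \<in> carrier G" and "g \<otimes>\<^bsub>G\<^esub> s \<notin> A"
      proof -
        show "g \<in> carrier G"
          using that by blast
        then have "g = (g \<otimes>\<^bsub>G\<^esub> s) \<otimes>\<^bsub>G\<^esub> inv\<^bsub>G\<^esub> s"
          using sA(2) by (simp add: m_assoc)
        then show "g \<otimes>\<^bsub>G\<^esub> s \<notin> A"
          using that(3) by blast
      qed
      then have gs: "g \<otimes>\<^bsub>G\<^esub> s \<in> carrier G - A"
        using sA(2) by simp
      have "\<phi> g (t i) = \<phi> (g \<otimes>\<^bsub>G\<^esub> s) (z i)" "\<phi> g (t j) = \<phi> (g \<otimes>\<^bsub>G\<^esub> s) (z j)"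
        using that z g sA(2) by (simp_all add: t_def composition_rule)
      moreover have "d (\<phi> (g \<otimes>\<^bsub>G\<^esub> s) (z i)) (\<phi> (g \<otimes>\<^bsub>G\<^esub> s) (z j)) \<le> \<rho> / 2 + \<rho> / 2"
        using z_out[OF that(1) gs] z_out[OF that(2) gs] gs z that(1,2) fX[OF k1]
          triangle[of "\<phi> (g \<otimes>\<^bsub>G\<^esub> s) (z i)" "\<phi> (g \<otimes>\<^bsub>G\<^esub> s) (y (f 1))" "\<phi> (g \<otimes>\<^bsub>G\<^esub> s) (z j)"]
          commute[of "\<phi> (g \<otimes>\<^bsub>G\<^esub> s) (z i)" "\<phi> (g \<otimes>\<^bsub>G\<^esub> s) (y (f 1))"]
        by (simp add: in_X del: group_hom.hom_mult)
      ultimately show ?thesis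
        using \<rho>(2) by simp
    qed
    have finite_far: "finite {g \<in> carrier G. d (\<phi> g (t i)) (\<phi> g (t j)) > \<epsilon>}"
      if "i \<in> {1..k}" "j \<in> {1..k}" "0 < \<epsilon>" for i j \<epsilon>
      by (rule expansive_asymptotic[OF \<open>group_action G (topspace X) \<phi>\<close> compact cont c
            tX[OF that(1)] tX[OF that(2)] finite_imageI[OF A(1)] t_close[OF that(1,2)] that(3)])
    have "t \<in> asymptotic_tuples G X d \<phi> k"
      unfolding asymptotic_tuples_def
    proof (intro CollectI conjI allI impI)
      show "t \<in> {1..k} \<rightarrow>\<^sub>E topspace X"
        using tX by (auto simp: t_def)
      fix \<epsilon> :: real
      assume "0 < \<epsilon>"
      let ?S = "\<Union>i\<in>{1..k}. \<Union>j\<in>{1..k}. {g \<in> carrier G. d (\<phi> g (t i)) (\<phi> g (t j)) > \<epsilon>}"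
      have "finite ?S"
        using finite_far \<open>0 < \<epsilon>\<close> by blast
      moreover have "\<forall>g\<in>carrier G - ?S. \<forall>i\<in>{1..k}. \<forall>j\<in>{1..k}. d (\<phi> g (t i)) (\<phi> g (t j)) \<le> \<epsilon>"
        by force
      moreover have "?S \<subseteq> carrier G"
        by blast
      ultimately show "\<exists>F. finite F \<and> F \<subseteq> carrier G \<and>
          (\<forall>g\<in>carrier G - F. \<forall>i\<in>{1..k}. \<forall>j\<in>{1..k}. d (\<phi> g (t i)) (\<phi> g (t j)) \<le> \<epsilon>)"
        by blast
    qed

    \<comment> \<open>Closeness to the given tuple\<close>
    moreover have "t \<in> W"
    proof -
      have "t i \<in> V i" if i: "i \<in> {1..k}" for i
      proof -
        have "\<phi> s (y (f i)) \<in> U (f i s)"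
          using y[OF f(1)[OF i]] s by blast
        then have "d (x i) (\<phi> s (y (f i))) < \<rho> / 2"
          unfolding f(2)[OF i] by (simp add: U_def)
        moreover have "d (\<phi> s (y (f i))) (\<phi> s (z i)) \<le> \<rho> / 2"
          using z_in[OF i] sA B(3) by blast
        moreover have "x i \<in> topspace X"
          using x i by auto
        ultimately have "d (x i) (t i) < r i"
          using triangle[of "x i" "\<phi> s (y (f i))" "t i"] in_X[OF sA(2) fX[OF i]] tX[OF i] \<rho>_le[OF i] i
          by (simp add: t_def)
        then have "t i \<in> mball (x i) (r i)"
          using \<open>x i \<in> topspace X\<close> tX[OF i] by simp
        then show ?thesis
          using r[OF i] by blast
      qed
      then have "t \<in> Pi\<^sub>E {1..k} V"
        by (auto simp: t_def)
      then show ?thesis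
        using V(3) by blast
    qed
    ultimately show ?thesis
      by blast
  qed
  then show "x \<in> (product_topology (\<lambda>_. X) {1..k}) closure_of (asymptotic_tuples G X d \<phi> k)"
    using x unfolding in_closure_of by auto
qed

end
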